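(* Suppose that a pattern $p$ uses $r$ distinct variables, where the $j$th variable occurs $k_j\ge 1$ times. Without loss of generality, let $k=|p|=k_1+\cdots+k_r$ and $1=k_1=\cdots=k_s<k_{s+1}\le\cdots\le k_r$. The mean number of occurrences of $p$ in a strictly partial word of length $n$ over an alphabet of $m$ letters is $$\widehat{\Omega}_n\sim\frac{n^{s+1}}{(s+1)!}\prod_{j=s+1}^r\frac{m2^{k_j}-m+1}{(m+1)^{k_j}-(m2^{k_j}-m+1)}.$$
   Context: A partial word over an alphabet $\mathcal A$ is a sequence of characters from $\mathcal A\cup\{\diamond\}$, where $\diamond\notin\mathcal A$ is the hole character; it is strictly partial if it has at least one hole. Two partial words $u=u_1\cdots u_N$ and $v=v_1\cdots v_N$ of equal length are compatible, written $u\uparrow v$, if $u_i=v_i$ whenever $u_i,v_i\in\mathcal A$. A pattern is a word $p$ over an alphabet $\mathcal V$ of variables, and $|p|$ is its length; a morphism $h:\mathcal V^*\to\mathcal A^*$ is nonerasing if $h(v)$ is nonempty for every $v\in\mathcal V$. A factor is a contiguous block. Occurrences are counted as follows: a partial word $w$ over $\mathcal A$ encounters $p$ a total of $N>0$ times if, for some maximal $M>0$, there exist $M$ distinct nonerasing morphisms $h_i:\mathcal V^*\to\mathcal A^*$ such that for some $t_1,\ldots,t_M>0$ there are $t_i>0$ factors $f_i$ of $w$ that satisfy $f_i\uparrow h_i(p)$, and $\sum_{i=1}^M t_i=N$ (factors are counted by position in $w$). The mean is over all $(m+1)^n-m^n$ strictly partial words of length $n$ over an alphabet $\mathcal A$ of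 $m$ letters. The notation $\sim$ means that the ratio of the two sides tends to $1$ as $n\to\infty$. Empty products equal $1$.
   Formalization: Occurrences are counted as (position, lengths of the h(v)) admitting a compatible h: morphisms differing only in how holes are filled count once (the literal count makes the claim false for m≥2); m=1 with s<r is excluded (zero denominators); the variable alphabet is the set of variables of p. *)

theory Defs
  imports "HOL-Library.FuncSet" "HOL-Library.Landau_Symbols" Complex_Main
begin

text \<open>A partial word is a list of options; \<open>None\<close> is the hole.\<close>

definition partial_words :: "'a set \<Rightarrow> nat \<Rightarrow> 'a option list set" where
  "partial_words A n = {w. set w \<subseteq> insert None (Some ` A) \<and> length w = n}"

definition strictly_partial_words :: "'a set \<Rightarrow> nat \<Rightarrow> 'a option list set" where
  "strictly_partial_words A n = {w \<in> partial_words A n. None \<in> set w}"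

definition compatible :: "'a option list \<Rightarrow> 'a option list \<Rightarrow> bool" (infix "\<up>" 50) where
  "u \<up> v \<longleftrightarrow> list_all2 (\<lambda>a b. a \<noteq> None \<and> b \<noteq> None \<longrightarrow> a = b) u v"

text \<open>
  A morphism \<open>V\<^sup>* \<Rightarrow> A\<^sup>*\<close> is given by its values on the variables. Extensionality makes two
  such functions distinct exactly when the morphisms are.
\<close>

definition nonerasing_morphisms :: "'v set \<Rightarrow> 'a set \<Rightarrow> ('v \<Rightarrow> 'a list) set" where
  "nonerasing_morphisms V A = V \<rightarrow>\<^sub>E {u \<in> lists A. u \<noteq> []}"

definition apply_morphism :: "('v \<Rightarrow> 'a list) \<Rightarrow> 'v list \<Rightarrow> 'a list" where
  "apply_morphism h p = concat (map h p)"

text \<open>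
  All pairs of a position \<open>i\<close> in \<open>w\<close> (counted from 0) and a nonerasing morphism \<open>h\<close> such that the
  factor of \<open>w\<close> of length \<open>|h(p)|\<close> starting at \<open>i\<close> is compatible with \<open>h(p)\<close>. The variable
  alphabet consists of the variables of \<open>p\<close>; further variables would have arbitrary images and
  make the number of morphisms infinite.
\<close>

definition encounters :: "'a set \<Rightarrow> 'a option list \<Rightarrow> 'v list \<Rightarrow> (nat \<times> ('v \<Rightarrow> 'a list)) set" where
  "encounters A w p =
     {(i, h). h \<in> nonerasing_morphisms (set p) A \<and>
        (let l = length (apply_morphism h p)
         in i + l \<le> length w \<and> take l (drop i w) \<up> map Some (apply_morphism h p))}"

text \<open>
  Occurrences are counted with multiplicity over positions and over the ways to divide the factor
  into images of the variables. Morphisms which, at the same position, have images of the same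
  lengths divide the factor in the same way and differ only in the letters they put
  for holes; they give one occurrence. (If every completion of the holes counted separately, the
  mean number of occurrences of a single variable would grow exponentially in the length of the
  word as soon as \<open>A\<close> has two letters.) On words without holes this identifies nothing, see
  \<open>num_occurrences_full\<close> below.
\<close>

definition num_occurrences :: "'a set \<Rightarrow> 'a option list \<Rightarrow> 'v list \<Rightarrow> nat" where
  "num_occurrences A w p =
     card ((\<lambda>(i, h). (i, \<lambda>v\<in>set p. length (h v))) ` encounters A w p)"

definition mean_occurrences :: "'a set \<Rightarrow> 'v list \<Rightarrow> nat \<Rightarrow> real" where
  "mean_occurrences A p n =
     (\<Sum>w\<in>strictly_partial_words A n. real (num_occurrences A w p)) /
       real (card (strictly_partial_words A n))"

lemma num_occurrences_full:
  assumes "None \<notin> set w"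
  shows "num_occurrences A w p = card (encounters A w p)"
  unfolding num_occurrences_def
proof (rule card_image, rule inj_onI, clarsimp)
  fix i g h
  assume g: "(i, g) \<in> encounters A w p" and h: "(i, h) \<in> encounters A w p"
    and eq: "(\<lambda>v\<in>set p. length (g v)) = (\<lambda>v\<in>set p. length (h v))"
  have len: "length (g v) = length (h v)" if "v \<in> set p" for v
    using fun_cong[OF eq, of v] that by simp
  have full: "u = map Some x" if "u \<up> map Some x" "None \<notin> set u" for u and x :: "'a list"
  proof (rule nth_equalityI)
    show "length u = length (map Some x)"
      using that(1) by (simp add: compatible_def list_all2_lengthD)
    show "u ! j = map Some x ! j" if "j < length u" for j
    proof -
      have "u ! j \<noteq> None"
      proof
        assume "u ! j = None"
        then show False
          using nth_mem[OF that] \<open>None \<notin> set u\<close> by simp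
      qed
      moreover have "length u = length x"
        using \<open>u \<up> map Some x\<close> by (simp add: compatible_def list_all2_conv_all_nth)
      ultimately show ?thesis
        using list_all2_nthD[OF \<open>u \<up> map Some x\<close>[unfolded compatible_def] that] that by simp
    qed
  qed
  have *: "take (length (apply_morphism f p)) (drop i w) = map Some (apply_morphism f p)"
    if "(i, f) \<in> encounters A w p" for f
  proof (rule full)
    show "take (length (apply_morphism f p)) (drop i w) \<up> map Some (apply_morphism f p)"
      using that by (simp add: encounters_def Let_def)
    show "None \<notin> set (take (length (apply_morphism f p)) (drop i w))"
      using assms by (blast dest: in_set_takeD in_set_dropD)
  qed
  have "length (concat (map g q)) = length (concat (map h q))" if "set q \<subseteq> set p" for q
    using that by (induction q) (simp_all add: len)
  then have "length (apply_morphism g p) = length (apply_morphism h p)"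
    by (simp add: apply_morphism_def)
  then have "map Some (apply_morphism g p) = map Some (apply_morphism h p)"
    using *[OF g] *[OF h] by argo
  then have "concat (map g p) = concat (map h p)"
    by (simp add: apply_morphism_def inj_map_eq_map[OF inj_Some])
  then have "map g p = map h p"
  proof (rule concat_injective)
    show "\<forall>(a, b)\<in>set (zip (map g p) (map h p)). length a = length b"
      using len by (auto simp: set_zip)
  qed simp
  moreover have "g \<in> extensional (set p)" "h \<in> extensional (set p)"
    using g h by (auto simp: encounters_def nonerasing_morphisms_def PiE_def)
  ultimately show "g = h"
    by (intro extensionalityI[of g "set p" h]) simp_all
qed

lemma card_strictly_partial_words:
  assumes "finite A"
  shows "card (strictly_partial_words A n) = (card A + 1) ^ n - card A ^ n"
proof -
  let ?B = "insert None (Some ` A)" and ?full = "{w. set w \<subseteq> Some ` A \<and> length w = n}"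
  have "strictly_partial_words A n = {w. set w \<subseteq> ?B \<and> length w = n} - ?full"
    unfolding strictly_partial_words_def partial_words_def by auto
  moreover have "?full \<subseteq> {w. set w \<subseteq> ?B \<and> length w = n}" by auto
  ultimately have "card (strictly_partial_words A n) = card ?B ^ n - card (Some ` A) ^ n"
    using assms
    by (simp add: card_Diff_subset card_lists_length_eq finite_lists_length_eq del: card_insert_disjoint)
  then show ?thesis
    using assms by (simp add: card_image)
qed

end

theory Submission
  imports Defs "HOL-Analysis.Uniform_Limit" "HOL-Real_Asymp.Real_Asymp"
begin

text \<open>
  Fix a position and the lengths \<open>l v\<close> of the images of the variables. If \<open>v\<close> occurs \<open>k\<close> times in
  \<open>p\<close>, then for each \<open>j < l v\<close> the \<open>k\<close> symbols at the \<open>j\<close>-th places of the images of \<open>v\<close> must be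
  pairwise compatible, which holds for \<open>m (2 ^ k - 1) + 1\<close> of the \<open>(m + 1) ^ k\<close> choices. Averaged
  over all partial words, the number of occurrences is therefore the sum of the products of
  \<open>q v ^ l v\<close> over all placements, where \<open>q v\<close> is the ratio of these two numbers. Variables that
  occur once have \<open>q v = 1\<close>, and with the position they contribute the binomial coefficient
  \<open>n + 1 choose s + 1\<close>; each other variable contributes, by dominated convergence (Tannery), the factor
  \<open>q v / (1 - q v)\<close>. Words without holes form an exponentially small fraction, while no word has
  more than polynomially many occurrences.
\<close>

section \<open>Weighted counts of placements of a pattern\<close>

text \<open>Here \<open>k v\<close> stands for the number of occurrences of \<open>v\<close>, so the
  sum is the length of the factor that starts at \<open>i\<close>. Multiplicities and variables are
  kept abstract, not read off a pattern, so that variables can be added one at a time.\<close>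

definition placements :: "('v \<Rightarrow> nat) \<Rightarrow> 'v set \<Rightarrow> nat \<Rightarrow> (nat \<times> ('v \<Rightarrow> nat)) set" where
  "placements k V N = {(i, l). l \<in> V \<rightarrow>\<^sub>E {1..} \<and> i + (\<Sum>v\<in>V. k v * l v) \<le> N}"

text \<open>With the ratios \<open>q\<close> chosen in \<open>sum_num_occurrences\<close>, each
  summand is the probability that a random partial word has an occurrence with the given
  placement.\<close>

definition placement_weight ::
  "('v \<Rightarrow> nat) \<Rightarrow> ('v \<Rightarrow> real) \<Rightarrow> 'v set \<Rightarrow> nat \<Rightarrow> real" where
  "placement_weight k q V N = (\<Sum>(i, l)\<in>placements k V N. \<Prod>v\<in>V. q v ^ l v)"

text \<open>Since \<open>k v\<close> is at least 1, no single \<open>l v\<close> exceeds the total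
  length. This crude box yields both finiteness and the polynomial bound that later controls the
  words without holes.\<close>

lemma placements_subset:
  assumes "finite V" "\<And>v. v \<in> V \<Longrightarrow> 1 \<le> k v"
  shows "placements k V N \<subseteq> {..N} \<times> (V \<rightarrow>\<^sub>E {1..N})"
proof clarsimp
  fix i l assume "(i, l) \<in> placements k V N"
  then have l: "l \<in> V \<rightarrow>\<^sub>E {1..}" and le: "i + (\<Sum>v\<in>V. k v * l v) \<le> N"
    by (auto simp: placements_def)
  have "l v \<le> N" if "v \<in> V" for v
  proof -
    have "l v \<le> k v * l v" using assms(2)[OF that] by simp
    also have "\<dots> \<le> (\<Sum>v\<in>V. k v * l v)"
      by (rule member_le_sum[OF that]) (simp_all add: assms(1))
    finally show ?thesis using le by simp
  qed
  then show "i \<le> N \<and> l \<in> V \<rightarrow>\<^sub>E {Suc 0..N}"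
    using l le by (auto simp: PiE_iff)
qed

lemma finite_placements:
  assumes "finite V" "\<And>v. v \<in> V \<Longrightarrow> 1 \<le> k v"
  shows "finite (placements k V N)"
  using placements_subset[OF assms] by (rule finite_subset) (simp_all add: assms(1) finite_PiE)

lemma card_placements_le:
  assumes "finite V" "\<And>v. v \<in> V \<Longrightarrow> 1 \<le> k v"
  shows "card (placements k V N) \<le> (N + 1) ^ (card V + 1)"
proof -
  have "card (placements k V N) \<le> card ({..N} \<times> (V \<rightarrow>\<^sub>E {1..N}))"
    by (rule card_mono[OF _ placements_subset[OF assms]]) (simp_all add: assms(1) finite_PiE)
  also have "\<dots> = (N + 1) * N ^ card V"
    using assms(1) by (simp add: card_cartesian_product card_PiE)
  also have "\<dots> \<le> (N + 1) * (N + 1) ^ card V"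
    by (intro mult_left_mono power_mono) simp_all
  finally show ?thesis by simp
qed

lemma placement_weight_empty: "placement_weight k q {} N = real N + 1"
proof -
  have "placements k {} N = (\<lambda>i. (i, \<lambda>_. undefined)) ` {..N}"
    by (auto simp: placements_def)
  then show ?thesis
    by (simp add: placement_weight_def card_image inj_on_def)
qed

text \<open>Only the total length of the images matters, not their order in the pattern. Fixing the
  length \<open>Suc a\<close> of the image of \<open>v\<close> therefore leaves a placement problem
  for \<open>V\<close> in a word shorter by \<open>k v * Suc a\<close>.\<close>

lemma placement_weight_insert:
  assumes V: "finite V" "v \<notin> V" and k: "\<And>u. u \<in> insert v V \<Longrightarrow> 1 \<le> k u"
  shows "placement_weight k q (insert v V) N =
    (\<Sum>a | k v * Suc a \<le> N. q v ^ Suc a * placement_weight k q V (N - k v * Suc a))"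
proof -
  have kv: "1 \<le> k v" using k by simp
  have fin: "finite {a. k v * Suc a \<le> N}"
  proof (rule finite_subset)
    show "{a. k v * Suc a \<le> N} \<subseteq> {..N}"
    proof
      fix a assume "a \<in> {a. k v * Suc a \<le> N}"
      moreover have "Suc a \<le> k v * Suc a" using kv by (cases "k v") simp_all
      ultimately show "a \<in> {..N}" by simp
    qed
  qed simp
  have fp: "\<And>M. finite (placements k V M)"
    by (rule finite_placements) (use V k in auto)
  have sum_upd: "(\<Sum>u\<in>V. k u * (if u = v then b else l u)) = (\<Sum>u\<in>V. k u * l u)" for b l
    by (rule sum.cong) (use V in auto)
  have prod_upd: "(\<Prod>u\<in>V. q u ^ (if u = v then b else l u)) = (\<Prod>u\<in>V. q u ^ l u)" for b l
    by (rule prod.cong) (use V in auto)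
  have "(\<Sum>a | k v * Suc a \<le> N. q v ^ Suc a * placement_weight k q V (N - k v * Suc a)) =
      (\<Sum>a | k v * Suc a \<le> N. \<Sum>z\<in>placements k V (N - k v * Suc a).
         q v ^ Suc a * (\<Prod>u\<in>V. q u ^ snd z u))"
    by (simp add: placement_weight_def sum_distrib_left case_prod_unfold)
  also have "\<dots> = (\<Sum>(a, z)\<in>(SIGMA a:{a. k v * Suc a \<le> N}. placements k V (N - k v * Suc a)).
         q v ^ Suc a * (\<Prod>u\<in>V. q u ^ snd z u))"
    by (rule sum.Sigma) (use fin fp in auto)
  also have "\<dots> = (\<Sum>z\<in>placements k (insert v V) N. \<Prod>u\<in>insert v V. q u ^ snd z u)"
  \<comment> \<open>Length functions on \<open>V\<close> are extensional, so their value at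
    \<open>v\<close> is \<open>undefined\<close>. Restoring this value makes the two maps inverse to
    each other.\<close>
  proof (rule sum.reindex_bij_witness[where
        j = "\<lambda>(a, (i, l)). (i, l(v := Suc a))" and
        i = "\<lambda>(i, l). (l v - 1, (i, l(v := undefined)))"])
    fix y assume "y \<in> (SIGMA a:{a. k v * Suc a \<le> N}. placements k V (N - k v * Suc a))"
    then obtain a i l where y: "y = (a, i, l)" "k v * Suc a \<le> N" "l \<in> V \<rightarrow>\<^sub>E {1..}"
      "i + (\<Sum>u\<in>V. k u * l u) \<le> N - k v * Suc a"
      by (auto simp: placements_def)
    have lv: "l v = undefined" using y(3) V(2) by (auto simp: PiE_iff extensional_def)
    show "(case (case y of (a, i, l) \<Rightarrow> (i, l(v := Suc a))) of
        (i, l) \<Rightarrow> (l v - 1, i, l(v := undefined))) = y"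
      using lv by (simp add: y(1) fun_upd_idem)
    have "l(v := Suc a) \<in> insert v V \<rightarrow>\<^sub>E {1..}"
      using y(3) by (intro PiE_fun_upd) auto
    moreover have "i + (\<Sum>u\<in>insert v V. k u * (l(v := Suc a)) u) \<le> N"
      using y(2,4) V by (simp add: sum_upd)
    ultimately show "(case y of (a, i, l) \<Rightarrow> (i, l(v := Suc a))) \<in> placements k (insert v V) N"
      by (simp add: y(1) placements_def)
    show "(\<Prod>u\<in>insert v V. q u ^ snd (case y of (a, i, l) \<Rightarrow> (i, l(v := Suc a))) u) =
        (case y of (a, z) \<Rightarrow> q v ^ Suc a * (\<Prod>u\<in>V. q u ^ snd z u))"
      using V by (simp add: y(1) prod_upd)
  next
    fix z assume "z \<in> placements k (insert v V) N"
    then obtain i l where z: "z = (i, l)" "l \<in> insert v V \<rightarrow>\<^sub>E {1..}"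
      "i + (\<Sum>u\<in>insert v V. k u * l u) \<le> N"
      by (auto simp: placements_def)
    have lv: "1 \<le> l v" using z(2) by (auto simp: PiE_iff)
    show "(case (case z of (i, l) \<Rightarrow> (l v - 1, i, l(v := undefined))) of
        (a, i, l) \<Rightarrow> (i, l(v := Suc a))) = z"
      using lv by (simp add: z(1))
    have "l(v := undefined) \<in> V \<rightarrow>\<^sub>E {1..}"
      using z(2) V(2) by (intro fun_upd_in_PiE) auto
    moreover have "Suc (l v - 1) = l v" using lv by simp
    ultimately show "(case z of (i, l) \<Rightarrow> (l v - 1, i, l(v := undefined)))
        \<in> (SIGMA a:{a. k v * Suc a \<le> N}. placements k V (N - k v * Suc a))"
      using z(3) V by (simp add: z(1) placements_def sum_upd del: mult_Suc_right)
  qed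
  finally show ?thesis by (simp add: placement_weight_def case_prod_unfold)
qed

text \<open>There are \<open>N + 1\<close> start positions without variables, and each variable of
  weight 1 sums the previous binomial coefficients along a column of Pascal's triangle (hockey-stick
  identity).\<close>

lemma placement_weight_single:
  assumes "finite V" "\<And>v. v \<in> V \<Longrightarrow> k v = 1" "\<And>v. v \<in> V \<Longrightarrow> q v = 1"
  shows "placement_weight k q V N = real ((N + 1) choose (card V + 1))"
  using assms
proof (induction V arbitrary: N rule: finite_induct)
  case empty
  show ?case by (simp add: placement_weight_empty)
next
  case (insert v V)
  have "placement_weight k q (insert v V) N =
    (\<Sum>a | k v * Suc a \<le> N. q v ^ Suc a * placement_weight k q V (N - k v * Suc a))"
    by (rule placement_weight_insert) (use insert in auto)
  also have "\<dots> = (\<Sum>a<N. real ((N - Suc a + 1) choose (card V + 1)))"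
    using insert by (intro sum.cong) auto
  also have "\<dots> = (\<Sum>a<N. real (Suc a choose (card V + 1)))"
    using sum.nat_diff_reindex[of "\<lambda>a. real (Suc a choose (card V + 1))" N] by simp
  \<comment> \<open>The shift adds the term \<open>0 choose (card V + 1)\<close>, which is
    0.\<close>
  also have "\<dots> = real (\<Sum>a<Suc N. a choose (card V + 1))"
    by (subst sum.lessThan_Suc_shift) simp
  also have "(\<Sum>a<Suc N. a choose (card V + 1)) = Suc N choose Suc (card V + 1)"
    unfolding lessThan_Suc_atMost by (rule sum_choose_upper)
  finally show ?case using insert by simp
qed

section \<open>Asymptotics of the weighted count\<close>

text \<open>Consecutive coefficients have the ratio \<open>(n + 1 - d) / (d + 1)\<close>.
  Normalising by \<open>real n + 1\<close> keeps the denominators positive also at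
  \<open>n = 0\<close>, so that convergence gives a bound valid for every \<open>n\<close> in the
  convolution below.\<close>

lemma choose_asymptotics:
  "(\<lambda>n. real ((n + 1) choose d) / (real n + 1) ^ d) \<longlonglongrightarrow> 1 / fact d"
proof (induction d)
  case (Suc d)
  have eq: "real ((n + 1) choose Suc d) / (real n + 1) ^ Suc d =
      real ((n + 1) choose d) / (real n + 1) ^ d * ((real n + 1 - real d) / ((real n + 1) * Suc d))"
    if "d \<le> n" for n
  proof -
    have "Suc d * ((n + 1) choose Suc d) = ((n + 1) - d) * ((n + 1) choose d)"
      using binomial_absorb_comp[of "n + 1" d] binomial_absorption[of d "n + 1"] by argo
    then have "real (Suc d * ((n + 1) choose Suc d)) = real (((n + 1) - d) * ((n + 1) choose d))"
      by (rule arg_cong)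
    moreover have "real ((n + 1) - d) = real n + 1 - real d" using that by (simp add: of_nat_diff)
    ultimately have "real (Suc d) * real ((n + 1) choose Suc d) = (real n + 1 - real d) * real ((n + 1) choose d)"
      by (simp only: of_nat_mult)
    then have "real ((n + 1) choose Suc d) = (real n + 1 - real d) * real ((n + 1) choose d) / Suc d"
      by (simp add: field_simps)
    then show ?thesis by (simp add: mult_ac del: binomial_Suc_Suc)
  qed
  have "(\<lambda>n. (real n + 1 - real d) / ((real n + 1) * Suc d)) \<longlonglongrightarrow> 1 / Suc d"
    by (real_asymp simp: divide_inverse)
  from tendsto_mult[OF Suc this] have
    "(\<lambda>n. real ((n + 1) choose d) / (real n + 1) ^ d * ((real n + 1 - real d) / ((real n + 1) * Suc d)))
      \<longlonglongrightarrow> 1 / fact d * (1 / Suc d)" .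
  also have "1 / fact d * (1 / Suc d) = (1 / fact (Suc d) :: real)"
    by simp
  finally have "(\<lambda>n. real ((n + 1) choose d) / (real n + 1) ^ d * ((real n + 1 - real d) / ((real n + 1) * Suc d)))
      \<longlonglongrightarrow> 1 / fact (Suc d)" .
  then show ?case
    by (rule Lim_transform_eventually) (use eventually_ge_at_top[of d] in \<open>rule eventually_mono, simp only: eq\<close>)
qed simp

text \<open>The geometric weights concentrate the sum on bounded \<open>j\<close>, where the shift
  by \<open>k * Suc j\<close> does not affect the leading order. The exponent \<open>d\<close>
  survives, and the constant gains the geometric series started at exponent 1.\<close>

lemma geometric_convolution_asymptotics:
  fixes a :: "nat \<Rightarrow> real" and q c :: real and k d :: nat
  assumes a: "(\<lambda>n. a n / (real n + 1) ^ d) \<longlonglongrightarrow> c"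
    and q: "0 \<le> q" "q < 1" and k: "1 \<le> k"
  shows "(\<lambda>n. (\<Sum>j | k * Suc j \<le> n. q ^ Suc j * a (n - k * Suc j)) / (real n + 1) ^ d)
    \<longlonglongrightarrow> c * (q / (1 - q))"
proof -
  \<comment> \<open>Extension by 0 turns the finite sums, whose range depends on \<open>n\<close>,
    into series over all \<open>j\<close>.\<close>
  define t where "t j n =
    (if k * Suc j \<le> n then q ^ Suc j * a (n - k * Suc j) / (real n + 1) ^ d else 0)" for j n
  obtain B where B: "\<And>n. \<bar>a n / (real n + 1) ^ d\<bar> \<le> B"
    using Bseq_conv_Bfun[of "\<lambda>n. a n / (real n + 1) ^ d"] convergent_imp_Bseq[OF convergentI[OF a]]
    by (auto simp: Bseq_def)
  have fin: "finite {j. k * Suc j \<le> n}" for n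
  proof (rule finite_subset)
    show "{j. k * Suc j \<le> n} \<subseteq> {..n}"
    proof
      fix j assume "j \<in> {j. k * Suc j \<le> n}"
      moreover have "Suc j \<le> k * Suc j" using k by (cases k) simp_all
      ultimately show "j \<in> {..n}" by simp
    qed
  qed simp
  have "(\<lambda>n. \<Sum>j. t j n) \<longlonglongrightarrow> (\<Sum>j. q ^ Suc j * c)"
  proof (rule tannerys_theorem[THEN conjunct2, THEN conjunct2])
    fix j
    \<comment> \<open>The sequence is considered at \<open>n + k * Suc j\<close>, which removes the
      natural subtraction; \<open>LIMSEQ_offset\<close> then undoes the shift.\<close>
    have "(\<lambda>n. (a n / (real n + 1) ^ d) * ((real n + 1) / (real (n + k * Suc j) + 1)) ^ d)
        \<longlonglongrightarrow> c * 1 ^ d"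
      by (intro tendsto_mult a tendsto_power) real_asymp
    then have "(\<lambda>n. q ^ Suc j * ((a n / (real n + 1) ^ d) * ((real n + 1) / (real (n + k * Suc j) + 1)) ^ d))
        \<longlonglongrightarrow> q ^ Suc j * c"
      by (intro tendsto_mult_left) simp
    moreover have "t j (n + k * Suc j) =
        q ^ Suc j * ((a n / (real n + 1) ^ d) * ((real n + 1) / (real (n + k * Suc j) + 1)) ^ d)" for n
      by (simp add: t_def power_divide del: mult_Suc_right power_Suc)
    ultimately have "(\<lambda>n. t j (n + k * Suc j)) \<longlonglongrightarrow> q ^ Suc j * c"
      by simp
    then show "(\<lambda>n. t j n) \<longlonglongrightarrow> q ^ Suc j * c"
      by (rule LIMSEQ_offset)
  next
    \<comment> \<open>The majorant is independent of \<open>n\<close>: the shifted argument is at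
      most \<open>n\<close>, so its value is at most \<open>B * (real n + 1) ^ d\<close> in absolute
      value.\<close>
    have "norm (t j n) \<le> B * q ^ Suc j" for j n
    proof (cases "k * Suc j \<le> n")
      case True
      let ?i = "n - k * Suc j"
      have "\<bar>a ?i\<bar> \<le> B * (real ?i + 1) ^ d"
        using B[of ?i] by (simp add: abs_divide field_simps)
      also have "\<dots> \<le> B * (real n + 1) ^ d"
        using B[of 0] by (intro mult_left_mono power_mono) auto
      finally have "\<bar>a ?i\<bar> / (real n + 1) ^ d \<le> B"
        by (simp add: field_simps)
      then have "q ^ Suc j * (\<bar>a ?i\<bar> / (real n + 1) ^ d) \<le> q ^ Suc j * B"
        using q by (intro mult_left_mono) simp_all
      then show ?thesis
        using True q by (simp add: t_def abs_mult mult.commute del: mult_Suc_right power_Suc)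
    qed (use q B[of 0] in \<open>simp add: t_def\<close>)
    then show "\<forall>\<^sub>F (j, n) in at_top \<times>\<^sub>F sequentially. norm (t j n) \<le> B * q ^ Suc j"
      by (intro always_eventually) auto
    show "summable (\<lambda>j. B * q ^ Suc j)"
      using q by (intro summable_mult summable_Suc_iff[THEN iffD2] summable_geometric) simp
  qed simp
  moreover have "(\<Sum>j. t j n) = (\<Sum>j | k * Suc j \<le> n. q ^ Suc j * a (n - k * Suc j)) / (real n + 1) ^ d" for n
  proof -
    have "(\<Sum>j. t j n) = (\<Sum>j | k * Suc j \<le> n. t j n)"
      by (rule suminf_finite[OF fin]) (simp add: t_def)
    also have "\<dots> = (\<Sum>j | k * Suc j \<le> n. q ^ Suc j * a (n - k * Suc j) / (real n + 1) ^ d)"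
      by (rule sum.cong) (simp_all add: t_def)
    finally show ?thesis by (simp add: sum_divide_distrib)
  qed
  moreover have "(\<Sum>j. q ^ Suc j * c) = c * (q / (1 - q))"
  proof -
    have "(\<lambda>j. q ^ j * (q * c)) sums (1 / (1 - q) * (q * c))"
      using q by (intro sums_mult2 geometric_sums) simp
    then show ?thesis by (simp add: sums_iff mult_ac)
  qed
  ultimately show ?thesis by simp
qed

text \<open>The set \<open>W\<close> alone determines the order of growth through a binomial
  coefficient. Each variable of \<open>V\<close> is then added by one convolution, which only
  changes the constant.\<close>

lemma placement_weight_asymptotics:
  assumes W: "finite W" "\<And>v. v \<in> W \<Longrightarrow> k v = 1" "\<And>v. v \<in> W \<Longrightarrow> q v = 1"
    and V: "finite V" "V \<inter> W = {}" "\<And>v. v \<in> V \<Longrightarrow> 1 \<le> k v" "\<And>v. v \<in> V \<Longrightarrow> 0 \<le> q v \<and> q v < 1"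
  shows "(\<lambda>n. placement_weight k q (V \<union> W) n / (real n + 1) ^ (card W + 1)) \<longlonglongrightarrow>
    1 / fact (card W + 1) * (\<Prod>v\<in>V. q v / (1 - q v))"
  using V
proof (induction V rule: finite_induct)
  case empty
  show ?case
    using choose_asymptotics[of "card W + 1"] by (simp add: placement_weight_single[OF W])
next
  case (insert v V)
  have "placement_weight k q (insert v V \<union> W) n = (\<Sum>a | k v * Suc a \<le> n.
      q v ^ Suc a * placement_weight k q (V \<union> W) (n - k v * Suc a))" for n
    unfolding Un_insert_left
    by (rule placement_weight_insert) (use insert W in auto)
  moreover have "(\<lambda>n. (\<Sum>a | k v * Suc a \<le> n.
      q v ^ Suc a * placement_weight k q (V \<union> W) (n - k v * Suc a)) / (real n + 1) ^ (card W + 1))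
      \<longlonglongrightarrow> (1 / fact (card W + 1) * (\<Prod>v\<in>V. q v / (1 - q v))) * (q v / (1 - q v))"
    by (rule geometric_convolution_asymptotics) (use insert in auto)
  ultimately show ?case
    using insert by (simp add: mult_ac)
qed

section \<open>Counting partial words with agreement prescribed on classes of positions\<close>

lemma partial_words_Suc_iff:
  "b # u \<in> partial_words A (Suc n) \<longleftrightarrow> b \<in> insert None (Some ` A) \<and> u \<in> partial_words A n"
  by (auto simp: partial_words_def)

lemma finite_partial_words: "finite A \<Longrightarrow> finite (partial_words A n)"
  unfolding partial_words_def by (rule finite_lists_length_eq) simp

lemma card_partial_words:
  assumes "finite A"
  shows "card (partial_words A n) = (card A + 1) ^ n"
proof -
  have "card (insert None (Some ` A)) = card A + 1"
    using assms by (simp add: card_image)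
  then show ?thesis
    unfolding partial_words_def using assms by (simp add: card_lists_length_eq)
qed

text \<open>
  \<open>cs\<close> assigns a class to each position; \<open>\<sigma>\<close> records the letters already forced on the classes,
  which is what makes the count below inductive.
\<close>

definition completable ::
  "'a set \<Rightarrow> ('c \<Rightarrow> 'a option) \<Rightarrow> 'c list \<Rightarrow> 'a option list set" where
  "completable A \<sigma> cs = {u \<in> partial_words A (length cs).
     \<exists>H. range H \<subseteq> A \<and> (\<forall>c a. \<sigma> c = Some a \<longrightarrow> H c = a) \<and> u \<up> map (Some \<circ> H) cs}"

lemma completable_subset: "completable A \<sigma> cs \<subseteq> partial_words A (length cs)"
  by (auto simp: completable_def)

text \<open>The function \<open>H\<close> is total, so classes without a forced letter need a
  default letter from \<open>A\<close>.\<close>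

lemma completable_Nil:
  assumes "A \<noteq> {}" "ran \<sigma> \<subseteq> A"
  shows "completable A \<sigma> [] = {[]}"
proof -
  obtain a0 where "a0 \<in> A" using assms(1) by blast
  moreover have "a \<in> A" if "\<sigma> c = Some a" for c a
    using assms(2) that by (meson ranI subsetD)
  ultimately have "range (\<lambda>c. case \<sigma> c of None \<Rightarrow> a0 | Some a \<Rightarrow> a) \<subseteq> A"
    by (auto split: option.splits)
  moreover have "\<forall>c a. \<sigma> c = Some a \<longrightarrow> (case \<sigma> c of None \<Rightarrow> a0 | Some a \<Rightarrow> a) = a"
    by simp
  ultimately have "\<exists>H. range H \<subseteq> A \<and> (\<forall>c a. \<sigma> c = Some a \<longrightarrow> H c = a)" by blast
  then show ?thesis
    by (auto simp: completable_def partial_words_def compatible_def)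
qed

text \<open>A hole leaves \<open>\<sigma>\<close> as it is, while a letter pins its class for all
  later positions. The pieces differ in their first symbol, so their cardinalities add up.\<close>

lemma completable_Cons:
  "completable A \<sigma> (c # cs) = Cons None ` completable A \<sigma> cs \<union>
     (\<Union>a\<in>{a \<in> A. \<sigma> c = None \<or> \<sigma> c = Some a}. Cons (Some a) ` completable A (\<sigma>(c \<mapsto> a)) cs)"
  (is "?l = ?r")
proof (intro set_eqI iffI)
  fix w assume "w \<in> ?l"
  then obtain H where w: "w \<in> partial_words A (Suc (length cs))" and H: "range H \<subseteq> A"
    "\<forall>c a. \<sigma> c = Some a \<longrightarrow> H c = a" "w \<up> map (Some \<circ> H) (c # cs)"
    by (auto simp: completable_def)
  obtain b u where bu: "w = b # u" using w by (cases w) (auto simp: partial_words_def)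
  have u: "u \<in> partial_words A (length cs)" "b \<in> insert None (Some ` A)"
    "b = None \<or> b = Some (H c)" "u \<up> map (Some \<circ> H) cs"
    using w H(3) by (auto simp: bu partial_words_Suc_iff compatible_def)
  show "w \<in> ?r"
  proof (cases b)
    case None
    then show ?thesis
      using u H by (auto simp: bu completable_def)
  next
    case (Some a)
    then have a: "a = H c" "a \<in> A" using u by auto
    then have "u \<in> completable A (\<sigma>(c \<mapsto> a)) cs"
      using u H unfolding completable_def by auto
    moreover have "\<sigma> c = None \<or> \<sigma> c = Some a"
      using H(2) a by (cases "\<sigma> c") auto
    ultimately show ?thesis
      using a Some by (auto simp: bu)
  qed
next
  fix w assume "w \<in> ?r"
  then consider u where "w = None # u" "u \<in> completable A \<sigma> cs"
    | a u where "w = Some a # u" "a \<in> A" "\<sigma> c = None \<or> \<sigma> c = Some a"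
        "u \<in> completable A (\<sigma>(c \<mapsto> a)) cs"
    by auto
  then show "w \<in> ?l"
  proof cases
    case 1
    then show ?thesis
      by (auto simp: completable_def partial_words_Suc_iff compatible_def)
  next
    case 2
    then obtain H where H: "u \<in> partial_words A (length cs)" "range H \<subseteq> A"
      "\<forall>d b. (\<sigma>(c \<mapsto> a)) d = Some b \<longrightarrow> H d = b" "u \<up> map (Some \<circ> H) cs"
      by (auto simp: completable_def)
    have Hc: "H c = a" using H(3) by simp
    have "\<forall>d b. \<sigma> d = Some b \<longrightarrow> H d = b"
    proof (intro allI impI)
      fix d b assume "\<sigma> d = Some b"
      then show "H d = b" using H(3) 2(3) by (cases "d = c") auto
    qed
    moreover have "w \<up> map (Some \<circ> H) (c # cs)"
      using H(4) Hc by (simp add: 2(1) compatible_def)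
    moreover have "w \<in> partial_words A (length (c # cs))"
      using H(1) 2(2) by (simp add: 2(1) partial_words_Suc_iff)
    ultimately show ?thesis
      using H(2) unfolding completable_def by blast
  qed
qed

text \<open>The classes are independent. In a class with a forced letter, each position is a hole or
  that letter. In a free class with \<open>t\<close> positions, either all are holes, or one of the
  letters fills a nonempty subset, which makes \<open>card A * (2 ^ t - 1) + 1\<close> choices.
  Classes of \<open>K\<close> that do not appear in \<open>cs\<close> contribute 1, so
  \<open>K\<close> can stay fixed in the induction.\<close>

lemma card_completable:
  assumes A: "finite A" "A \<noteq> {}" and K: "finite K" "set cs \<subseteq> K" and "ran \<sigma> \<subseteq> A"
  shows "card (completable A \<sigma> cs) = (\<Prod>c\<in>K. if \<sigma> c = None
    then card A * (2 ^ count_list cs c - 1) + 1 else 2 ^ count_list cs c)"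
  using K(2) \<open>ran \<sigma> \<subseteq> A\<close>
proof (induction cs arbitrary: \<sigma>)
  case Nil
  have "(\<Prod>c\<in>K. if \<sigma> c = None then card A * (2 ^ count_list [] c - 1) + 1
      else 2 ^ count_list [] c) = (\<Prod>c\<in>K. 1::nat)"
    by (intro prod.cong) auto
  then show ?case using completable_Nil[OF A(2) Nil(2)] by simp
next
  case (Cons c cs)
  define g where "g \<tau> ds d = (if \<tau> d = None
    then card A * (2 ^ count_list ds d - 1) + 1 else 2 ^ count_list ds d)" for \<tau> :: "'b \<Rightarrow> 'a option" and ds d
  let ?S = "{a \<in> A. \<sigma> c = None \<or> \<sigma> c = Some a}"
  let ?R = "\<Prod>d\<in>K - {c}. g \<sigma> cs d"
  have fin: "finite (completable A \<tau> cs)" for \<tau> :: "'b \<Rightarrow> 'a option"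
    by (rule finite_subset[OF completable_subset finite_partial_words[OF A(1)]])
  have cK: "c \<in> K" and csK: "set cs \<subseteq> K" using Cons.prems by auto
  \<comment> \<open>Neither prepending \<open>c\<close> nor forcing a letter on \<open>c\<close>
    affects the factors of the other classes.\<close>
  have rest: "(\<Prod>d\<in>K. g \<tau> ds d) = g \<tau> ds c * ?R"
    if "\<And>d. d \<noteq> c \<Longrightarrow> g \<tau> ds d = g \<sigma> cs d" for \<tau> ds
    using that by (subst prod.remove[OF K(1) cK]) (auto intro!: prod.cong)
  have IH: "card (completable A \<tau> cs) = (\<Prod>d\<in>K. g \<tau> cs d)" if "ran \<tau> \<subseteq> A" for \<tau>
    unfolding g_def by (rule Cons.IH[OF csK that])
  have "card (completable A \<sigma> (c # cs)) = card (completable A \<sigma> cs) +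
      card (\<Union>a\<in>?S. Cons (Some a) ` completable A (\<sigma>(c \<mapsto> a)) cs)"
    unfolding completable_Cons
    by (subst card_Un_disjoint) (use A fin in \<open>auto simp: card_image\<close>)
  also have "card (\<Union>a\<in>?S. Cons (Some a) ` completable A (\<sigma>(c \<mapsto> a)) cs) =
      (\<Sum>a\<in>?S. card (completable A (\<sigma>(c \<mapsto> a)) cs))"
    by (subst card_UN_disjoint) (use A fin in \<open>auto simp: card_image\<close>)
  also have "\<dots> = (\<Sum>a\<in>?S. 2 ^ count_list cs c * ?R)"
  proof (rule sum.cong[OF refl])
    fix a assume "a \<in> ?S"
    then have "ran (\<sigma>(c \<mapsto> a)) \<subseteq> A"
      using Cons.prems(2) by (auto simp: ran_def)
    then have "card (completable A (\<sigma>(c \<mapsto> a)) cs) = g (\<sigma>(c \<mapsto> a)) cs c * ?R"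
      using IH rest[of "\<sigma>(c \<mapsto> a)" cs] by (simp add: g_def)
    then show "card (completable A (\<sigma>(c \<mapsto> a)) cs) = 2 ^ count_list cs c * ?R"
      by (simp add: g_def)
  qed
  also have "\<dots> = card ?S * 2 ^ count_list cs c * ?R" by simp
  also have "card (completable A \<sigma> cs) = g \<sigma> cs c * ?R"
    using IH[OF Cons.prems(2)] rest[of \<sigma> cs] by simp
  also have "g \<sigma> cs c * ?R + card ?S * 2 ^ count_list cs c * ?R = g \<sigma> (c # cs) c * ?R"
  proof (cases "\<sigma> c")
    case None
    then have "?S = A" by auto
    \<comment> \<open>Writing the power as a successor eliminates the natural subtraction in
      \<open>g\<close>.\<close>
    moreover obtain t :: nat where "2 ^ count_list cs c = Suc t"
      by (metis not0_implies_Suc power_not_zero zero_neq_numeral)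
    ultimately show ?thesis using None by (simp add: g_def algebra_simps)
  next
    case (Some a)
    then have "?S = {a}" using Cons.prems(2) by (auto simp: ran_def)
    then show ?thesis using Some by (simp add: g_def algebra_simps)
  qed
  also have "\<dots> = (\<Prod>d\<in>K. g \<sigma> (c # cs) d)"
    by (rule rest[symmetric]) (simp add: g_def)
  finally show ?case by (simp add: g_def)
qed

section \<open>Occurrences expressed by classes of positions\<close>

text \<open>
  The \<open>j\<close>-th letters of all the images of one variable \<open>v\<close> have to agree, so they form the
  class \<open>(v, j)\<close>.
\<close>

definition positions :: "('v \<Rightarrow> nat) \<Rightarrow> 'v list \<Rightarrow> ('v \<times> nat) list" where
  "positions l p = concat (map (\<lambda>v. map (Pair v) [0..<l v]) p)"

lemma count_list_positions:
  "count_list (positions l p) (v, j) = (if j < l v then count_list p v else 0)"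
proof (induction p)
  case (Cons u p)
  have "count_list (map (Pair u) [0..<l u]) (v, j) = (if u = v \<and> j < l v then 1 else 0)"
  proof -
    have "count_list (map (Pair u) [0..<i]) (v, j) = (if u = v \<and> j < i then 1 else 0)" for i
      by (induction i) auto
    then show ?thesis by auto
  qed
  then show ?case using Cons by (simp add: positions_def)
qed (simp add: positions_def)

lemma set_positions: "set (positions l p) = (SIGMA v:set p. {..<l v})"
  by (auto simp: positions_def)

lemma length_positions: "length (positions l p) = (\<Sum>v\<in>set p. count_list p v * l v)"
proof -
  have "length (positions l p) = sum_list (map l p)"
    by (simp add: positions_def length_concat o_def)
  then show ?thesis by (simp add: sum_list_map_eq_sum_count)
qed

lemma card_completable_positions:
  assumes "finite A" "A \<noteq> {}"
  shows "card (completable A (\<lambda>_. None) (positions l p)) =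
    (\<Prod>v\<in>set p. (card A * (2 ^ count_list p v - 1) + 1) ^ l v)"
proof -
  have "card (completable A (\<lambda>_. None) (positions l p)) = (\<Prod>(v, j)\<in>(SIGMA v:set p. {..<l v}).
      card A * (2 ^ count_list (positions l p) (v, j) - 1) + 1)"
    using card_completable[of A "set (positions l p)" "positions l p" "\<lambda>_. None"] assms
    by (simp add: set_positions case_prod_unfold)
  also have "\<dots> = (\<Prod>(v, j)\<in>(SIGMA v:set p. {..<l v}). card A * (2 ^ count_list p v - 1) + 1)"
    by (rule prod.cong) (auto simp: count_list_positions)
  also have "\<dots> = (\<Prod>v\<in>set p. \<Prod>j<l v. card A * (2 ^ count_list p v - 1) + 1)"
    by (rule prod.Sigma[symmetric]) auto
  finally show ?thesis by simp
qed

text \<open>Pairs of a position and image lengths are exactly what \<open>num_occurrences\<close>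
  distinguishes; the morphism itself survives only as the existential \<open>H\<close> in
  \<open>completable\<close>.\<close>

definition occurrences :: "'a set \<Rightarrow> 'a option list \<Rightarrow> 'v list \<Rightarrow> (nat \<times> ('v \<Rightarrow> nat)) set" where
  "occurrences A w p = {(i, l) \<in> placements (count_list p) (set p) (length w).
     take (length (positions l p)) (drop i w) \<in> completable A (\<lambda>_. None) (positions l p)}"

text \<open>A morphism with image lengths \<open>l\<close> amounts to a letter for each class
  \<open>(v, j)\<close>, namely the \<open>j\<close>-th letter of the image of
  \<open>v\<close>.\<close>

lemma num_occurrences_eq_card:
  assumes A: "A \<noteq> {}" and w: "w \<in> partial_words A n"
  shows "num_occurrences A w p = card (occurrences A w p)"
proof -
  have "(\<lambda>(i, h). (i, \<lambda>v\<in>set p. length (h v))) ` encounters A w p = occurrences A w p"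
    (is "?f ` _ = _")
  proof (intro equalityI subsetI)
    fix z assume "z \<in> ?f ` encounters A w p"
    then obtain i h where z: "z = (i, \<lambda>v\<in>set p. length (h v))"
      and h: "h \<in> nonerasing_morphisms (set p) A"
      and le: "i + length (apply_morphism h p) \<le> length w"
      and comp: "take (length (apply_morphism h p)) (drop i w) \<up> map Some (apply_morphism h p)"
      by (auto simp: encounters_def Let_def)
    define l where "l = (\<lambda>v\<in>set p. length (h v))"
    have hv: "h v \<noteq> []" "set (h v) \<subseteq> A" if "v \<in> set p" for v
      using h that by (auto simp: nonerasing_morphisms_def PiE_iff)
    obtain a0 where a0: "a0 \<in> A" using A by blast
    \<comment> \<open>The default \<open>a0\<close> outside the actual classes keeps the range of
      the total function \<open>H\<close> inside \<open>A\<close>.\<close>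
    define H where "H = (\<lambda>(v, j). if v \<in> set p \<and> j < length (h v) then h v ! j else a0)"
    have "range H \<subseteq> A"
      using a0 hv(2) nth_mem by (fastforce simp: H_def)
    have "map (\<lambda>j. H (v, j)) [0..<l v] = h v" if "v \<in> set p" for v
      using that by (intro nth_equalityI) (simp_all add: l_def H_def)
    then have eq: "apply_morphism h p = map H (positions l p)"
      by (auto simp: apply_morphism_def positions_def map_concat o_def intro!: arg_cong[of _ _ concat])
    then have len: "length (apply_morphism h p) = length (positions l p)" by simp
    have "l \<in> set p \<rightarrow>\<^sub>E {1..}"
      using hv by (auto simp: l_def Suc_le_eq)
    then have "(i, l) \<in> placements (count_list p) (set p) (length w)"
      using le by (simp add: placements_def len length_positions)
    moreover have "take (length (positions l p)) (drop i w) \<in> partial_words A (length (positions l p))"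
      using w le len by (auto simp: partial_words_def dest!: in_set_takeD in_set_dropD)
    ultimately show "z \<in> occurrences A w p"
      using \<open>range H \<subseteq> A\<close> comp unfolding len
      by (auto simp: occurrences_def completable_def z l_def[symmetric] eq)
  next
    fix z assume "z \<in> occurrences A w p"
    then obtain i l H where z: "z = (i, l)" "(i, l) \<in> placements (count_list p) (set p) (length w)"
      and H: "range H \<subseteq> A"
        "take (length (positions l p)) (drop i w) \<up> map (Some \<circ> H) (positions l p)"
      by (auto simp: occurrences_def completable_def)
    define h where "h = (\<lambda>v\<in>set p. map (\<lambda>j. H (v, j)) [0..<l v])"
    have l: "l \<in> set p \<rightarrow>\<^sub>E {1..}" and le: "i + length (positions l p) \<le> length w"
      using z(2) by (auto simp: placements_def length_positions)
    have eq: "apply_morphism h p = map H (positions l p)"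
      by (auto simp: apply_morphism_def positions_def map_concat o_def h_def intro!: arg_cong[of _ _ concat])
    have "h \<in> nonerasing_morphisms (set p) A"
      using range_subsetD[OF H(1)] l by (auto simp: nonerasing_morphisms_def h_def PiE_iff)
    then have "(i, h) \<in> encounters A w p"
      using le H(2) by (simp add: encounters_def eq)
    moreover have "l = (\<lambda>v\<in>set p. length (h v))"
      using l by (auto simp: h_def PiE_iff extensional_def fun_eq_iff)
    ultimately show "z \<in> ?f ` encounters A w p"
      unfolding z(1) by (intro image_eqI[where x = "(i, h)"]) simp_all
  qed
  then show ?thesis by (simp add: num_occurrences_def)
qed

section \<open>The average over all partial words\<close>

text \<open>Cutting out the factor leaves two unconstrained pieces of total length
  \<open>n - L\<close>, so the count does not depend on \<open>i\<close>.\<close>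

lemma card_words_with_factor:
  assumes A: "finite A" and C: "C \<subseteq> partial_words A L" and le: "i + L \<le> n"
  shows "card {w \<in> partial_words A n. take L (drop i w) \<in> C} = (card A + 1) ^ (n - L) * card C"
proof -
  let ?f = "\<lambda>(x, u, y). x @ u @ y"
  have "bij_betw ?f (partial_words A i \<times> C \<times> partial_words A (n - i - L))
      {w \<in> partial_words A n. take L (drop i w) \<in> C}"
  proof (rule bij_betw_byWitness[where f' = "\<lambda>w. (take i w, take L (drop i w), drop L (drop i w))"])
    show "\<forall>t\<in>partial_words A i \<times> C \<times> partial_words A (n - i - L).
        (take i (?f t), take L (drop i (?f t)), drop L (drop i (?f t))) = t"
      using C by (auto simp: partial_words_def)
    show "\<forall>w\<in>{w \<in> partial_words A n. take L (drop i w) \<in> C}.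
        ?f (take i w, take L (drop i w), drop L (drop i w)) = w"
      by (simp del: drop_drop)
    show "?f ` (partial_words A i \<times> C \<times> partial_words A (n - i - L))
        \<subseteq> {w \<in> partial_words A n. take L (drop i w) \<in> C}"
    proof
      fix w assume "w \<in> ?f ` (partial_words A i \<times> C \<times> partial_words A (n - i - L))"
      then obtain x u y where w: "w = x @ u @ y"
        and *: "x \<in> partial_words A i" "u \<in> C" "y \<in> partial_words A (n - i - L)"
        by auto
      then have "length x = i" "length u = L" "u \<in> partial_words A L"
        using C by (auto simp: partial_words_def)
      then show "w \<in> {w \<in> partial_words A n. take L (drop i w) \<in> C}"
        using * le by (auto simp: w partial_words_def)
    qed
    show "(\<lambda>w. (take i w, take L (drop i w), drop L (drop i w))) `
        {w \<in> partial_words A n. take L (drop i w) \<in> C}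
        \<subseteq> partial_words A i \<times> C \<times> partial_words A (n - i - L)"
      using le by (auto simp: partial_words_def dest!: in_set_takeD in_set_dropD)
  qed
  then have "card {w \<in> partial_words A n. take L (drop i w) \<in> C} =
      card (partial_words A i \<times> C \<times> partial_words A (n - i - L))"
    by (simp add: bij_betw_same_card)
  also have "\<dots> = (card A + 1) ^ (i + (n - i - L)) * card C"
    by (simp add: card_cartesian_product card_partial_words[OF A] power_add)
  also have "i + (n - i - L) = n - L" using le by simp
  finally show ?thesis .
qed

text \<open>Double counting: for each placement, the words that realise it are counted by
  \<open>card_words_with_factor\<close> and \<open>card_completable_positions\<close>.\<close>

lemma sum_num_occurrences:
  assumes A: "finite A" "A \<noteq> {}"
  shows "(\<Sum>w\<in>partial_words A n. real (num_occurrences A w p)) / (real (card A) + 1) ^ n =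
    placement_weight (count_list p)
      (\<lambda>v. (real (card A) * (2 ^ count_list p v - 1) + 1) / (real (card A) + 1) ^ count_list p v)
      (set p) n"
proof -
  let ?P = "placements (count_list p) (set p) n" and ?M = "real (card A) + 1"
  let ?g = "\<lambda>v. real (card A) * (2 ^ count_list p v - 1) + 1"
  let ?C = "\<lambda>l. completable A (\<lambda>_. None) (positions l p)"
  let ?Q = "\<lambda>z w. take (length (positions (snd z) p)) (drop (fst z) w) \<in> ?C (snd z)"
  have finP: "finite ?P"
    by (rule finite_placements) (simp_all add: Suc_le_eq count_list_0_iff flip: neq0_conv)
  have "(\<Sum>w\<in>partial_words A n. num_occurrences A w p) =
      (\<Sum>w\<in>partial_words A n. \<Sum>z\<in>?P. if ?Q z w then 1 else 0)"
  proof (rule sum.cong[OF refl])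
    fix w assume w: "w \<in> partial_words A n"
    then have "occurrences A w p = {z \<in> ?P. ?Q z w}"
      by (auto simp: occurrences_def partial_words_def)
    then show "num_occurrences A w p = (\<Sum>z\<in>?P. if ?Q z w then 1 else 0)"
      using num_occurrences_eq_card[OF A(2) w, of p] finP by (simp flip: sum.inter_filter)
  qed
  also have "\<dots> = (\<Sum>z\<in>?P. \<Sum>w\<in>partial_words A n. if ?Q z w then 1 else 0)"
    by (rule sum.swap)
  also have "\<dots> = (\<Sum>z\<in>?P. card {w \<in> partial_words A n. ?Q z w})"
    using finite_partial_words[OF A(1)] by (simp flip: sum.inter_filter)
  finally have "(\<Sum>w\<in>partial_words A n. real (num_occurrences A w p)) =
      (\<Sum>z\<in>?P. real (card {w \<in> partial_words A n. ?Q z w}))"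
    by (simp flip: of_nat_sum)
  then have "(\<Sum>w\<in>partial_words A n. real (num_occurrences A w p)) / ?M ^ n =
      (\<Sum>z\<in>?P. real (card {w \<in> partial_words A n. ?Q z w}) / ?M ^ n)"
    by (simp add: sum_divide_distrib)
  also have "\<dots> = (\<Sum>z\<in>?P. \<Prod>v\<in>set p. (?g v / ?M ^ count_list p v) ^ snd z v)"
  proof (rule sum.cong[OF refl])
    fix z assume "z \<in> ?P"
    then obtain i l where z: "z = (i, l)" and le: "i + length (positions l p) \<le> n"
      by (auto simp: placements_def length_positions)
    let ?L = "length (positions l p)"
    have "card {w \<in> partial_words A n. ?Q z w} = (card A + 1) ^ (n - ?L) * card (?C l)"
      unfolding z using card_words_with_factor[OF A(1) completable_subset le] by simp
    then have "real (card {w \<in> partial_words A n. ?Q z w}) = ?M ^ (n - ?L) * (\<Prod>v\<in>set p. ?g v ^ l v)"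
      by (simp add: card_completable_positions[OF A] of_nat_diff add.commute)
    \<comment> \<open>The symbols of the factor are grouped by variable, so that each power in the
      numerator gets its own denominator.\<close>
    moreover have "?M ^ n = ?M ^ (n - ?L) * (\<Prod>v\<in>set p. (?M ^ count_list p v) ^ l v)"
    proof -
      have "(\<Prod>v\<in>set p. (?M ^ count_list p v) ^ l v) = ?M ^ ?L"
        by (simp add: length_positions power_sum flip: power_mult)
      then show ?thesis using le by (simp flip: power_add)
    qed
    ultimately show "real (card {w \<in> partial_words A n. ?Q z w}) / ?M ^ n =
        (\<Prod>v\<in>set p. (?g v / ?M ^ count_list p v) ^ snd z v)"
      by (simp add: z prod_dividef power_divide)
  qed
  finally show ?thesis by (simp add: placement_weight_def case_prod_unfold)
qed

section \<open>Passage to strictly partial words\<close>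

lemma num_occurrences_le:
  assumes "A \<noteq> {}" "w \<in> partial_words A n"
  shows "num_occurrences A w p \<le> (n + 1) ^ (card (set p) + 1)"
proof -
  have k: "\<And>v. v \<in> set p \<Longrightarrow> 1 \<le> count_list p v"
    by (simp add: Suc_le_eq count_list_0_iff flip: neq0_conv)
  have "occurrences A w p \<subseteq> placements (count_list p) (set p) n"
    using assms by (auto simp: occurrences_def partial_words_def)
  then have "card (occurrences A w p) \<le> card (placements (count_list p) (set p) n)"
    by (intro card_mono finite_placements k) auto
  also have "\<dots> \<le> (n + 1) ^ (card (set p) + 1)"
    by (intro card_placements_le k) auto
  finally show ?thesis unfolding num_occurrences_eq_card[OF assms] .
qed

text \<open>\<open>E\<close> is the contribution of the words without holes, bounded by their
  proportion times the maximal number of occurrences. The denominator is the proportion of words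
  with a hole.\<close>

lemma mean_occurrences_eq:
  assumes A: "finite A" "A \<noteq> {}"
  obtains E where
    "\<And>n. mean_occurrences A p n =
       ((\<Sum>w\<in>partial_words A n. real (num_occurrences A w p)) / (real (card A) + 1) ^ n - E n) /
       (1 - (real (card A) / (real (card A) + 1)) ^ n)"
    "\<And>n. 0 \<le> E n"
    "\<And>n. E n \<le> (real n + 1) ^ (card (set p) + 1) * (real (card A) / (real (card A) + 1)) ^ n"
proof
  let ?M = "real (card A) + 1"
  define F where "F n = partial_words A n - strictly_partial_words A n" for n
  define E where "E n = (\<Sum>w\<in>F n. real (num_occurrences A w p)) / ?M ^ n" for n
  fix n
  have sub: "strictly_partial_words A n \<subseteq> partial_words A n"
    by (auto simp: strictly_partial_words_def)
  note fin = finite_partial_words[OF A(1), of n]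
  have cardS: "real (card (strictly_partial_words A n)) = ?M ^ n - real (card A) ^ n"
    using card_strictly_partial_words[OF A(1), of n]
    by (simp add: of_nat_diff power_mono add.commute)
  have S: "(\<Sum>w\<in>strictly_partial_words A n. real (num_occurrences A w p)) =
      (\<Sum>w\<in>partial_words A n. real (num_occurrences A w p)) -
      (\<Sum>w\<in>F n. real (num_occurrences A w p))"
    using sum.subset_diff[OF sub fin, of "\<lambda>w. real (num_occurrences A w p)"] by (simp add: F_def)
  have M: "?M ^ n \<noteq> 0" by simp
  \<comment> \<open>This holds even if \<open>?M ^ n = c\<close>, as happens for
    \<open>n = 0\<close>: both sides are then divisions by 0.\<close>
  have "(a - b) / (?M ^ n - c) = (a / ?M ^ n - b / ?M ^ n) / (1 - c / ?M ^ n)" for a b c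
  proof -
    have "a / ?M ^ n - b / ?M ^ n = (a - b) / ?M ^ n" "1 - c / ?M ^ n = (?M ^ n - c) / ?M ^ n"
      using M by (simp_all add: diff_divide_distrib)
    then show ?thesis using M by simp
  qed
  then show "mean_occurrences A p n =
       ((\<Sum>w\<in>partial_words A n. real (num_occurrences A w p)) / ?M ^ n - E n) /
       (1 - (real (card A) / ?M) ^ n)"
    unfolding mean_occurrences_def S cardS E_def power_divide .
  show "0 \<le> E n"
    unfolding E_def by (intro divide_nonneg_nonneg sum_nonneg) auto
  have "real (card (F n)) = real (card A) ^ n"
    using card_Diff_subset[OF finite_subset[OF sub fin] sub] card_mono[OF fin sub] cardS
      card_partial_words[OF A(1), of n]
    by (simp add: F_def of_nat_diff add.commute)
  moreover have "(\<Sum>w\<in>F n. real (num_occurrences A w p)) \<le>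
      (\<Sum>w\<in>F n. (real n + 1) ^ (card (set p) + 1))"
  proof (rule sum_mono)
    fix w assume "w \<in> F n"
    then have "real (num_occurrences A w p) \<le> real ((n + 1) ^ (card (set p) + 1))"
      using num_occurrences_le[OF A(2), of w n p] by (intro of_nat_mono) (simp add: F_def)
    then show "real (num_occurrences A w p) \<le> (real n + 1) ^ (card (set p) + 1)"
      by (simp add: algebra_simps)
  qed
  ultimately have "(\<Sum>w\<in>F n. real (num_occurrences A w p)) \<le>
      real (card A) ^ n * (real n + 1) ^ (card (set p) + 1)"
    by simp
  then show "E n \<le> (real n + 1) ^ (card (set p) + 1) * (real (card A) / ?M) ^ n"
    unfolding E_def power_divide by (simp add: divide_right_mono mult.commute)
qed

lemma polynomial_times_geometric_tendsto_0:
  fixes \<rho> :: real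
  assumes "0 < \<rho>" "\<rho> < 1"
  shows "(\<lambda>n. (real n + 1) ^ d * \<rho> ^ n) \<longlonglongrightarrow> 0"
  using assms by real_asymp

text \<open>Both \<open>E\<close> and the deviation of the denominator from 1 tend to 0, so the
  limit is that of the average over all partial words.\<close>

lemma mean_occurrences_asymptotics:
  assumes A: "finite A" "A \<noteq> {}"
    and lim: "(\<lambda>n. placement_weight (count_list p)
      (\<lambda>v. (real (card A) * (2 ^ count_list p v - 1) + 1) / (real (card A) + 1) ^ count_list p v)
      (set p) n / (real n + 1) ^ d) \<longlonglongrightarrow> c"
  shows "(\<lambda>n. mean_occurrences A p n / (real n + 1) ^ d) \<longlonglongrightarrow> c"
proof -
  let ?\<rho> = "real (card A) / (real (card A) + 1)"
  obtain E where mean: "\<And>n. mean_occurrences A p n =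
       ((\<Sum>w\<in>partial_words A n. real (num_occurrences A w p)) / (real (card A) + 1) ^ n - E n) /
       (1 - ?\<rho> ^ n)"
    and E: "\<And>n. 0 \<le> E n" "\<And>n. E n \<le> (real n + 1) ^ (card (set p) + 1) * ?\<rho> ^ n"
    using mean_occurrences_eq[OF A] by blast
  have \<rho>: "0 < ?\<rho>" "?\<rho> < 1"
    using A by (simp_all add: card_gt_0_iff)
  have "E \<longlonglongrightarrow> 0"
    by (rule tendsto_sandwich[OF _ _ tendsto_const
        polynomial_times_geometric_tendsto_0[OF \<rho>, of "card (set p) + 1"]])
      (use E in auto)
  then have E0: "(\<lambda>n. E n / (real n + 1) ^ d) \<longlonglongrightarrow> 0"
  proof (rule tendsto_sandwich[OF _ _ tendsto_const, rotated 2])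
    show "\<forall>\<^sub>F n in sequentially. 0 \<le> E n / (real n + 1) ^ d"
      using E by auto
    show "\<forall>\<^sub>F n in sequentially. E n / (real n + 1) ^ d \<le> E n"
    proof (rule always_eventually, rule allI)
      fix n
      have "E n * 1 \<le> E n * (real n + 1) ^ d"
        using E(1) by (intro mult_left_mono one_le_power) auto
      then show "E n / (real n + 1) ^ d \<le> E n" by (simp add: divide_le_eq)
    qed
  qed
  have "(\<lambda>n. 1 - ?\<rho> ^ n) \<longlonglongrightarrow> 1 - 0"
    using \<rho> by (intro tendsto_diff tendsto_const LIMSEQ_realpow_zero) auto
  from tendsto_divide[OF tendsto_diff[OF lim E0] this]
  show ?thesis
    unfolding mean sum_num_occurrences[OF A] by (simp add: diff_divide_distrib mult.commute)
qed

section \<open>The asymptotic formula for the mean\<close>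

text \<open>The left side counts the compatible tuples among all \<open>k\<close>-tuples of symbols.
  Equality holds for \<open>k = 1\<close> and for \<open>m = 1\<close>, so strictness must come from
  the nonvanishing denominators in the theorem.\<close>

lemma compatible_tuples_le_power:
  fixes m :: real
  assumes "1 \<le> m"
  shows "m * (2 ^ k - 1) + 1 \<le> (m + 1) ^ k"
proof (induction k)
  case (Suc k)
  have "m * (2 ^ Suc k - 1) + 1 = (m * (2 ^ k - 1) + 1) + m * 2 ^ k"
    by (simp add: algebra_simps)
  also have "\<dots> \<le> (m + 1) ^ k + m * (m + 1) ^ k"
    using assms by (intro add_mono Suc mult_left_mono power_mono) auto
  finally show ?case by (simp add: algebra_simps)
qed simp

text \<open>The last hypothesis excludes division by 0: over a single letter all partial words of
  equal length are compatible, and every denominator in the product vanishes.\<close>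

theorem theorem9:
  fixes A :: "'a set" and p :: "'v list" and x :: "nat \<Rightarrow> 'v" and k :: "nat \<Rightarrow> nat"
    and m r s :: nat
  assumes "finite A" and "card A = m" and "m \<ge> 1"
    and "bij_betw x {1..r} (set p)"
    and "\<And>j. j \<in> {1..r} \<Longrightarrow> k j = count_list p (x j)"
    and "s \<le> r"
    and "\<And>j. j \<in> {1..s} \<Longrightarrow> k j = 1"
    and "\<And>j. j \<in> {s+1..r} \<Longrightarrow> 1 < k j"
    and "mono_on {1..r} k"
    and "\<And>j. j \<in> {s+1..r} \<Longrightarrow> (real m + 1) ^ k j - (real m * 2 ^ k j - real m + 1) \<noteq> 0"
  shows "(\<lambda>n. mean_occurrences A p n) \<sim>[at_top]
    (\<lambda>n. real n ^ (s + 1) / fact (s + 1) *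
      (\<Prod>j=s+1..r. (real m * 2 ^ k j - real m + 1) /
        ((real m + 1) ^ k j - (real m * 2 ^ k j - real m + 1))))"
proof -
  define W V where "W = x ` {1..s}" and "V = x ` {s+1..r}"
  define g where "g j = real m * 2 ^ j - real m + 1" for j :: nat
  define q where "q v = (real (card A) * (2 ^ count_list p v - 1) + 1) /
    (real (card A) + 1) ^ count_list p v" for v
  let ?c = "\<Prod>j=s+1..r. g (k j) / ((real m + 1) ^ k j - g (k j))"
  have A: "A \<noteq> {}" using assms(2,3) by auto
  have inj: "inj_on x {1..r}" and img: "x ` {1..r} = set p"
    using assms(4) by (simp_all add: bij_betw_def)
  have indices: "{1..r} = {s+1..r} \<union> {1..s}" using assms(6) by auto
  have VW: "V \<union> W = set p" unfolding V_def W_def img[symmetric] indices by blast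
  have disj: "V \<inter> W = {}"
    unfolding V_def W_def
    by (subst inj_on_image_Int[OF inj, symmetric]) (use assms(6) in auto)
  have cardW: "card W = s"
    unfolding W_def using assms(6) by (subst card_image[OF inj_on_subset[OF inj]]) auto
  have kW: "count_list p v = 1" if "v \<in> W" for v
    using that assms(5-7) by (force simp: W_def)
  have q: "q (x j) = g (k j) / (real m + 1) ^ k j" if "j \<in> {1..r}" for j
    using assms(2) assms(5)[OF that] by (simp add: q_def g_def algebra_simps)
  have g_pos: "0 < g j" for j
  proof -
    have "0 \<le> real m * (2 ^ j - 1)" by simp
    then show ?thesis by (simp add: g_def algebra_simps)
  qed
  have g_less: "g (k j) < (real m + 1) ^ k j" if "j \<in> {s+1..r}" for j
    using compatible_tuples_le_power[of "real m" "k j"] assms(3) assms(10)[OF that]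
    by (simp add: g_def algebra_simps)
  have "(\<lambda>n. placement_weight (count_list p) q (V \<union> W) n / (real n + 1) ^ (card W + 1)) \<longlonglongrightarrow>
    1 / fact (card W + 1) * (\<Prod>v\<in>V. q v / (1 - q v))"
  proof (rule placement_weight_asymptotics)
    show "1 \<le> count_list p v" if "v \<in> V" for v
      using that assms(5,6,8) by (force simp: V_def)
    show "0 \<le> q v \<and> q v < 1" if v: "v \<in> V" for v
    proof -
      obtain j where "v = x j" "j \<in> {s+1..r}" using v unfolding V_def by blast
      then show ?thesis
        using q[of j] g_pos[of "k j"] g_less[of j] by simp
    qed
  qed (use disj kW in \<open>auto simp: V_def W_def q_def\<close>)
  moreover have "(\<Prod>v\<in>V. q v / (1 - q v)) = ?c"
    unfolding V_def
  proof (subst prod.reindex[OF inj_on_subset[OF inj]], force, rule prod.cong[OF refl])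
    fix j assume j: "j \<in> {s+1..r}"
    then have "q (x j) = g (k j) / (real m + 1) ^ k j" by (intro q) auto
    moreover have "1 - g (k j) / (real m + 1) ^ k j = ((real m + 1) ^ k j - g (k j)) / (real m + 1) ^ k j"
      by (simp add: diff_divide_distrib)
    ultimately show "((\<lambda>v. q v / (1 - q v)) \<circ> x) j = g (k j) / ((real m + 1) ^ k j - g (k j))"
      by simp
  qed
  ultimately have "(\<lambda>n. placement_weight (count_list p) q (set p) n / (real n + 1) ^ (s + 1))
      \<longlonglongrightarrow> 1 / fact (s + 1) * ?c"
    by (simp only: VW cardW)
  then have "(\<lambda>n. mean_occurrences A p n / (real n + 1) ^ (s + 1)) \<longlonglongrightarrow> 1 / fact (s + 1) * ?c"
    unfolding q_def by (rule mean_occurrences_asymptotics[OF assms(1) A])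
  \<comment> \<open>Only a nonzero limit turns convergence of the quotient into asymptotic
    equivalence.\<close>
  moreover have "1 / fact (s + 1) * ?c \<noteq> 0"
    using g_less g_pos by (force simp: less_imp_neq[OF g_pos, symmetric])
  ultimately have "mean_occurrences A p \<sim>[at_top] (\<lambda>n. (1 / fact (s + 1) * ?c) * (real n + 1) ^ (s + 1))"
    by (rule asymp_equivI'_const)
  also have "\<dots> \<sim>[at_top] (\<lambda>n. (1 / fact (s + 1) * ?c) * real n ^ (s + 1))"
    by (intro asymp_equiv_intros) real_asymp
  finally show ?thesis by (simp add: g_def mult_ac)
qed

end
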